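(* Let $d\ge 2$ be an integer. For $n\ge d+1$ let $G_{d,n}$ be a uniformly random $d$-regular digraph on the vertex set $[n]=\{1,\dots,n\}$, with adjacency matrix $A_{d,n}\in\{0,1\}^{n\times n}$. Then for every integer $k\ge 0$ and every word $w=w_1\cdots w_k\in\{1,*\}^k$, $$\frac1n\,\mathbb E\big[\operatorname{Tr}(A_{d,n}^w)\big]\;\xrightarrow[n\to\infty]{}\;M_d(w):=A_d^w(o,o),$$ where $A_d$ is the adjacency matrix of the $d$-regular directed tree $T_d$ with root $o$, and for vertices $v,v'\in T_d$, $$A_d^w(v,v'):=\sum_{\substack{v_0,v_1,\dots,v_k\in T_d\\ v_0=v,\ v_k=v'}}A_d^{w_1}(v_0,v_1)\,A_d^{w_2}(v_1,v_2)\cdots A_d^{w_k}(v_{k-1},v_k).$$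
   Context: A digraph here is simple: no loops and no multiple arcs (two opposite arcs $(u,v)$ and $(v,u)$ are allowed). It is $d$-regular if every vertex has in-degree $d$ and out-degree $d$. Its adjacency matrix $A$ has $A(u,v)=1$ if $(u,v)$ is an arc and $A(u,v)=0$ otherwise. "Uniformly random" means uniform over the finite set of all $d$-regular digraphs on the labeled vertex set $[n]$. For a matrix $A$, $A^1:=A$ and $A^*$ is its adjoint (here, its transpose). For a finite word $w=w_1\cdots w_k$ on $\{1,*\}$, $A^w:=A^{w_1}\cdots A^{w_k}$; for the empty word ($k=0$), $A^w$ is the identity matrix, so $A_d^w(v,v')$ is $1$ if $v=v'$ and $0$ otherwise. The $d$-regular directed tree $T_d$ is the unique infinite, connected, acyclic digraph (it has no cycle even when arc orientations are disregarded) in which every vertex has in-degree and out-degree $d$. Equivalently, it is the Cayley graph of the free group $F_d=\langle e_1,\dots,e_d\rangle$: vertices are the elements of $F_d$, with arcs $(v,v e_i)$ for $v\in F_d$, $i\in[d]$; the root $o$ is the identity element. *)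

theory Defs
  imports
    "HOL-Probability.Probability"
    "HOL-Algebra.Group"
    "Graph_Theory.Pair_Digraph"
    "Jordan_Normal_Form.Matrix"
begin

datatype letter = One | Star

type_synonym word = "letter list"

definition regular_digraph :: "nat \<Rightarrow> ('a, 'b) pre_digraph \<Rightarrow> bool" where
  "regular_digraph d G \<longleftrightarrow> (\<forall>v \<in> verts G. in_degree G v = d \<and> out_degree G v = d)"

text \<open>
  The locale predicate \<open>pair_digraph\<close> says finite and loop-free; parallel arcs are excluded by
  representing an arc as the pair of its endpoints.
\<close>

definition regular_digraphs :: "nat \<Rightarrow> nat \<Rightarrow> nat pair_pre_digraph set" where
  "regular_digraphs d n =
     {G. pair_digraph G \<and> pverts G = {1..n} \<and> regular_digraph d (with_proj G)}"

text \<open>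
  The set \<open>regular_digraphs d n\<close> is finite, and for \<open>n \<ge> d + 1\<close> it is nonempty (circulant
  digraphs), so that \<open>pmf_of_set\<close> is then the uniform distribution on it. No meaning is attached
  to the other values of \<open>n\<close>.
\<close>

definition random_regular_digraph :: "nat \<Rightarrow> nat \<Rightarrow> nat pair_pre_digraph pmf" where
  "random_regular_digraph d n = pmf_of_set (regular_digraphs d n)"

definition adjacency :: "'a pair_pre_digraph \<Rightarrow> 'a \<Rightarrow> 'a \<Rightarrow> real" where
  "adjacency G u v = (if (u, v) \<in> parcs G then 1 else 0)"

text \<open>Matrix indices start at 0, whereas the vertex set is \<open>{1..n}\<close>.\<close>

definition adjacency_mat :: "nat \<Rightarrow> nat pair_pre_digraph \<Rightarrow> real mat" where
  "adjacency_mat n G = mat n n (\<lambda>(i, j). adjacency G (i + 1) (j + 1))"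

fun mat_letter :: "'a mat \<Rightarrow> letter \<Rightarrow> 'a mat" where
  "mat_letter A One = A"
| "mat_letter A Star = transpose_mat A"

primrec mat_word :: "'a :: semiring_1 mat \<Rightarrow> word \<Rightarrow> 'a mat" where
  "mat_word A [] = 1\<^sub>m (dim_row A)"
| "mat_word A (s # w) = mat_letter A s * mat_word A w"

definition mat_trace :: "'a :: comm_monoid_add mat \<Rightarrow> 'a" where
  "mat_trace A = (\<Sum>i<dim_row A. A $$ (i, i))"

fun entry_letter :: "('a \<Rightarrow> 'a \<Rightarrow> real) \<Rightarrow> letter \<Rightarrow> 'a \<Rightarrow> 'a \<Rightarrow> real" where
  "entry_letter A One x y = A x y"
| "entry_letter A Star x y = A y x"

text \<open>
  The list \<open>p\<close> is the sequence \<open>v\<^sub>0, \<dots>, v\<^sub>k\<close> with \<open>k = length w\<close>. The index set is infinite in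
  general, but in a digraph with finite in- and out-degrees only finitely many terms are nonzero.
\<close>

definition entry_word :: "'a pair_pre_digraph \<Rightarrow> word \<Rightarrow> 'a \<Rightarrow> 'a \<Rightarrow> real" where
  "entry_word G w v v' =
     (\<Sum>\<^sub>\<infinity>p \<in> {p. length p = length w + 1 \<and> set p \<subseteq> pverts G \<and> p ! 0 = v \<and> p ! length w = v'}.
        \<Prod>i<length w. entry_letter (adjacency G) (w ! i) (p ! i) (p ! (i + 1)))"

text \<open>
  The pair \<open>(i, True)\<close> is the generator \<open>e\<^sub>i\<close> and \<open>(i, False)\<close> is its inverse. Elements of the
  free group are the reduced words, multiplied by concatenation followed by free reduction.
\<close>

type_synonym fletter = "nat \<times> bool"

definition flip :: "fletter \<Rightarrow> fletter" where
  "flip x = (fst x, \<not> snd x)"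

definition freely_reduced :: "fletter list \<Rightarrow> bool" where
  "freely_reduced u \<longleftrightarrow> successively (\<lambda>x y. y \<noteq> flip x) u"

fun rcons :: "fletter \<Rightarrow> fletter list \<Rightarrow> fletter list" where
  "rcons x [] = [x]"
| "rcons x (y # u) = (if y = flip x then u else x # y # u)"

definition free_group :: "nat \<Rightarrow> fletter list monoid" where
  "free_group d =
     \<lparr> carrier = {u. freely_reduced u \<and> fst ` set u \<subseteq> {1..d}},
       mult = (\<lambda>u v. foldr rcons u v),
       one = [] \<rparr>"

definition free_gen :: "nat \<Rightarrow> fletter list" where
  "free_gen i = [(i, True)]"

lemma flip_flip [simp]: "flip (flip x) = x"
  and fst_flip [simp]: "fst (flip x) = fst x"
  and flip_neq [simp]: "flip x \<noteq> x" "x \<noteq> flip x"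
  by (auto simp: flip_def prod_eq_iff)

lemma flip_eq_iff: "x = flip y \<longleftrightarrow> flip x = y"
  by auto

lemma freely_reduced_Nil [simp]: "freely_reduced []"
  by (simp add: freely_reduced_def)

lemma freely_reduced_Cons: "freely_reduced (x # u) \<longleftrightarrow> freely_reduced u \<and> (u = [] \<or> hd u \<noteq> flip x)"
  by (cases u) (auto simp: freely_reduced_def)

lemma freely_reduced_rcons: "freely_reduced u \<Longrightarrow> freely_reduced (rcons x u)"
  by (cases u) (auto simp: freely_reduced_Cons)

lemma freely_reduced_foldr_rcons: "freely_reduced v \<Longrightarrow> freely_reduced (foldr rcons u v)"
  by (induction u) (auto intro: freely_reduced_rcons)

lemma fst_set_rcons: "fst ` set (rcons x u) \<subseteq> insert (fst x) (fst ` set u)"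
  by (cases u) auto

lemma fst_set_foldr_rcons: "fst ` set (foldr rcons u v) \<subseteq> fst ` set u \<union> fst ` set v"
proof (induction u)
  case (Cons x u)
  have "fst ` set (foldr rcons (x # u) v) \<subseteq> insert (fst x) (fst ` set (foldr rcons u v))"
    using fst_set_rcons[of x "foldr rcons u v"] by simp
  also have "\<dots> \<subseteq> insert (fst x) (fst ` set u \<union> fst ` set v)"
    using Cons.IH by blast
  finally show ?case by simp
qed simp

lemma rcons_flip_rcons: "freely_reduced u \<Longrightarrow> rcons (flip x) (rcons x u) = u"
proof (cases u)
  case (Cons y v)
  assume "freely_reduced u"
  then show ?thesis using Cons by (cases v) (auto simp: freely_reduced_Cons)
qed simp

lemma rcons_rcons_flip: "freely_reduced u \<Longrightarrow> rcons x (rcons (flip x) u) = u"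
  using rcons_flip_rcons[of u "flip x"] by simp

lemma foldr_rcons_rcons:
  assumes "freely_reduced v"
  shows "foldr rcons (rcons x u) v = rcons x (foldr rcons u v)"
  by (cases u) (use assms in \<open>auto simp: rcons_rcons_flip freely_reduced_foldr_rcons\<close>)

lemma foldr_rcons_assoc:
  "freely_reduced w \<Longrightarrow> foldr rcons (foldr rcons u v) w = foldr rcons u (foldr rcons v w)"
  by (induction u) (auto simp: foldr_rcons_rcons)

lemma foldr_rcons_Nil: "freely_reduced u \<Longrightarrow> foldr rcons u [] = u"
proof (induction u)
  case (Cons x u)
  then show ?case by (cases u) (auto simp: freely_reduced_Cons)
qed simp

lemma foldr_rcons_inverse: "freely_reduced v \<Longrightarrow> foldr rcons (map flip (rev u)) (foldr rcons u v) = v"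
  by (induction u arbitrary: v) (auto simp: rcons_flip_rcons freely_reduced_foldr_rcons)

lemma group_free_group: "group (free_group d)"
proof (rule groupI)
  fix u v
  assume "u \<in> carrier (free_group d)" "v \<in> carrier (free_group d)"
  then show "u \<otimes>\<^bsub>free_group d\<^esub> v \<in> carrier (free_group d)"
    using order_trans[OF fst_set_foldr_rcons[of u v], of "{1..d}"]
    by (simp add: free_group_def freely_reduced_foldr_rcons)
next
  fix u
  assume u: "u \<in> carrier (free_group d)"
  define v where "v = foldr rcons (map flip (rev u)) []"
  have "foldr rcons v u = foldr rcons (map flip (rev u)) (foldr rcons u [])"
    using u by (simp add: v_def foldr_rcons_assoc foldr_rcons_Nil free_group_def)
  then have "foldr rcons v u = []"
    by (simp add: foldr_rcons_inverse)
  moreover have "v \<in> carrier (free_group d)"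
    using u fst_set_foldr_rcons[of "map flip (rev u)" "[]"]
    by (force simp: v_def free_group_def freely_reduced_foldr_rcons)
  ultimately show "\<exists>v \<in> carrier (free_group d). v \<otimes>\<^bsub>free_group d\<^esub> u = \<one>\<^bsub>free_group d\<^esub>"
    by (auto simp: free_group_def)
qed (auto simp: free_group_def foldr_rcons_assoc)

definition cayley_digraph :: "('a, 'b) monoid_scheme \<Rightarrow> 'a set \<Rightarrow> 'a pair_pre_digraph" where
  "cayley_digraph G S =
     \<lparr> pverts = carrier G, parcs = {(v, v \<otimes>\<^bsub>G\<^esub> s) | v s. v \<in> carrier G \<and> s \<in> S} \<rparr>"

definition directed_tree :: "nat \<Rightarrow> fletter list pair_pre_digraph" where
  "directed_tree d = cayley_digraph (free_group d) (free_gen ` {1..d})"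

definition tree_root :: "nat \<Rightarrow> fletter list" where
  "tree_root d = \<one>\<^bsub>free_group d\<^esub>"

definition tree_moment :: "nat \<Rightarrow> word \<Rightarrow> real" where
  "tree_moment d w = entry_word (directed_tree d) w (tree_root d) (tree_root d)"

lemma regular_cayley_digraph:
  assumes "group G" and S: "S \<subseteq> carrier G"
  shows "regular_digraph (card S) (with_proj (cayley_digraph G S))"
proof -
  interpret group G by fact
  have "in_degree (with_proj (cayley_digraph G S)) v = card S"
    and "out_degree (with_proj (cayley_digraph G S)) v = card S" if v: "v \<in> carrier G" for v
  proof -
    have "in_arcs (with_proj (cayley_digraph G S)) v = (\<lambda>s. (v \<otimes>\<^bsub>G\<^esub> inv\<^bsub>G\<^esub> s, v)) ` S"
    proof (intro equalityI subsetI)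
      fix e
      assume "e \<in> in_arcs (with_proj (cayley_digraph G S)) v"
      then obtain u s where "e = (u, v)" "u \<in> carrier G" "s \<in> S" "v = u \<otimes>\<^bsub>G\<^esub> s"
        by (auto simp: in_arcs_def cayley_digraph_def)
      moreover from this have "u = v \<otimes>\<^bsub>G\<^esub> inv\<^bsub>G\<^esub> s"
        using S by (auto simp: m_assoc subset_iff)
      ultimately show "e \<in> (\<lambda>s. (v \<otimes>\<^bsub>G\<^esub> inv\<^bsub>G\<^esub> s, v)) ` S"
        by blast
    next
      fix e
      assume "e \<in> (\<lambda>s. (v \<otimes>\<^bsub>G\<^esub> inv\<^bsub>G\<^esub> s, v)) ` S"
      then obtain s where s: "s \<in> S" "e = (v \<otimes>\<^bsub>G\<^esub> inv\<^bsub>G\<^esub> s, v)"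
        by blast
      moreover have "v = (v \<otimes>\<^bsub>G\<^esub> inv\<^bsub>G\<^esub> s) \<otimes>\<^bsub>G\<^esub> s" "v \<otimes>\<^bsub>G\<^esub> inv\<^bsub>G\<^esub> s \<in> carrier G"
        using S v s by (auto simp: m_assoc subset_iff)
      ultimately show "e \<in> in_arcs (with_proj (cayley_digraph G S)) v"
        by (auto simp: in_arcs_def cayley_digraph_def)
    qed
    moreover have "inj_on (\<lambda>s. (v \<otimes>\<^bsub>G\<^esub> inv\<^bsub>G\<^esub> s, v)) S"
      using v S by (auto simp: inj_on_def subset_iff)
    ultimately show "in_degree (with_proj (cayley_digraph G S)) v = card S"
      by (simp add: in_degree_def card_image)
    have "out_arcs (with_proj (cayley_digraph G S)) v = (\<lambda>s. (v, v \<otimes>\<^bsub>G\<^esub> s)) ` S"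
      using v by (auto simp: out_arcs_def cayley_digraph_def)
    moreover have "inj_on (\<lambda>s. (v, v \<otimes>\<^bsub>G\<^esub> s)) S"
      using v S by (auto simp: inj_on_def subset_iff)
    ultimately show "out_degree (with_proj (cayley_digraph G S)) v = card S"
      by (simp add: out_degree_def card_image)
  qed
  then show ?thesis
    by (simp add: regular_digraph_def cayley_digraph_def)
qed

lemma regular_directed_tree: "regular_digraph d (with_proj (directed_tree d))"
proof -
  have "free_gen ` {1..d} \<subseteq> carrier (free_group d)"
    by (auto simp: free_gen_def free_group_def freely_reduced_Cons)
  moreover have "card (free_gen ` {1..d}) = d"
    by (simp add: card_image inj_on_def free_gen_def)
  ultimately show ?thesis
    using regular_cayley_digraph[OF group_free_group, of "free_gen ` {1..d}" d]
    by (simp add: directed_tree_def)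
qed

end

theory Submission
  imports Defs
begin

text \<open>
  The trace counts closed walks with prescribed step directions. In every \<open>d\<close>-regular digraph the
  number of such walks that reduce to the trivial walk by cancelling backtracks is the same, namely
  \<open>moment d w []\<close>, and in the tree all closed walks do. A closed walk at \<open>v\<close> that does not reduce
  to the trivial one yields an arc \<open>(x, y)\<close> near \<open>v\<close> whose endpoints stay joined by a short path
  after the arc is deleted. A switching argument shows that a random regular digraph has a bounded
  expected number of such arcs, so only \<open>O(1)\<close> vertices in expectation contribute an error.
\<close>

section \<open>Walks as stacks and the cancellation of backtracks\<close>

definition arc :: "letter \<Rightarrow> 'a \<Rightarrow> 'a \<Rightarrow> 'a \<times> 'a" where
  "arc a x y = (case a of One \<Rightarrow> (x, y) | Star \<Rightarrow> (y, x))"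

definition nbrs :: "('a \<times> 'a) set \<Rightarrow> letter \<Rightarrow> 'a \<Rightarrow> 'a set" where
  "nbrs E a x = {y. arc a x y \<in> E}"

lemma arc_simps [simp]: "arc One x y = (x, y)" "arc Star x y = (y, x)"
  by (simp_all add: arc_def)

lemma nbrs_converse: "a \<noteq> b \<Longrightarrow> y \<in> nbrs E a x \<longleftrightarrow> x \<in> nbrs E b y"
  by (cases a; cases b) (auto simp: nbrs_def)

text \<open>These numbers are the entries of the word \<open>w\<close> in the adjacency matrix; the
  recursion peels off the first letter, as \<open>mat_word\<close> does.\<close>

primrec nwalks :: "('a \<times> 'a) set \<Rightarrow> word \<Rightarrow> 'a \<Rightarrow> 'a \<Rightarrow> nat" where
  "nwalks E [] x v = (if x = v then 1 else 0)"
| "nwalks E (a # w) x v = (\<Sum>y\<in>nbrs E a x. nwalks E w y v)"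

text \<open>
  A stack \<open>(a\<^sub>m, u\<^sub>m), \<dots>, (a\<^sub>1, u\<^sub>1)\<close> records a walk, latest step first: \<open>(a, u)\<close> is a step of
  type \<open>a\<close> that leaves \<open>u\<close>. Pushing a step which retraces the top of the stack cancels it.
\<close>

fun push :: "letter \<Rightarrow> 'a \<Rightarrow> 'a \<Rightarrow> (letter \<times> 'a) list \<Rightarrow> (letter \<times> 'a) list" where
  "push a x y [] = [(a, x)]"
| "push a x y ((b, u) # s) = (if b \<noteq> a \<and> u = y then s else (a, x) # (b, u) # s)"

text \<open>Reduced walks from \<open>v\<close> to \<open>x\<close>. A backtrack is a change of type
  together with a return to the previous vertex. Two steps of equal type there and back use opposite
  arcs, hence do not cancel.\<close>

fun nb_walk :: "('a \<times> 'a) set \<Rightarrow> 'a \<Rightarrow> (letter \<times> 'a) list \<Rightarrow> 'a \<Rightarrow> bool" where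
  "nb_walk E v [] x \<longleftrightarrow> x = v"
| "nb_walk E v ((a, u) # s) x \<longleftrightarrow>
     x \<in> nbrs E a u \<and> nb_walk E v s u \<and> (s = [] \<or> fst (hd s) = a \<or> snd (hd s) \<noteq> x)"

primrec nullwalks :: "('a \<times> 'a) set \<Rightarrow> word \<Rightarrow> 'a \<Rightarrow> (letter \<times> 'a) list \<Rightarrow> nat" where
  "nullwalks E [] x s = (if s = [] then 1 else 0)"
| "nullwalks E (a # w) x s = (\<Sum>y\<in>nbrs E a x. nullwalks E w y (push a x y s))"

text \<open>
  \<open>moment d w s\<close> counts the walks along \<open>w\<close> which cancel a stack with step types \<open>s\<close>: of the \<open>d\<close>
  steps of a type other than \<open>hd s\<close>, exactly one retraces the top of the stack.
\<close>

primrec moment :: "nat \<Rightarrow> word \<Rightarrow> letter list \<Rightarrow> nat" where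
  "moment d [] s = (if s = [] then 1 else 0)"
| "moment d (a # w) s =
     (if s \<noteq> [] \<and> hd s \<noteq> a then moment d w (tl s) + (d - 1) * moment d w (a # s)
      else d * moment d w (a # s))"

lemma nb_walk_push:
  "nb_walk E v s x \<Longrightarrow> y \<in> nbrs E a x \<Longrightarrow> nb_walk E v (push a x y s) y"
  by (cases s) auto

lemma length_push: "length (push a x y s) \<le> Suc (length s)"
  by (cases s) auto

text \<open>\<open>V\<close> may be infinite, so that the tree and the finite digraphs are treated
  together; positivity of \<open>d\<close> turns the cardinality condition into finiteness of all
  neighbourhoods.\<close>

locale regular_arcs =
  fixes d :: nat and V :: "'a set" and E :: "('a \<times> 'a) set"
  assumes arcs: "E \<subseteq> V \<times> V"
    and card_nbrs: "\<And>v a. v \<in> V \<Longrightarrow> card (nbrs E a v) = d"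
    and pos: "d > 0"
begin

lemma finite_nbrs: "v \<in> V \<Longrightarrow> finite (nbrs E a v)"
  using card_nbrs[of v a] pos by (intro card_ge_0_finite) simp

lemma nbrs_subset: "nbrs E a v \<subseteq> V"
  using arcs by (cases a) (auto simp: nbrs_def)

lemma nwalks_le: "x \<in> V \<Longrightarrow> nwalks E w x v \<le> d ^ length w"
proof (induction w arbitrary: x)
  case (Cons a w)
  have "nwalks E (a # w) x v \<le> (\<Sum>y\<in>nbrs E a x. d ^ length w)"
    unfolding nwalks.simps using Cons nbrs_subset by (intro sum_mono) blast
  then show ?case using card_nbrs Cons by simp
qed simp

lemma nullwalks_le: "x \<in> V \<Longrightarrow> nullwalks E w x s \<le> d ^ length w"
proof (induction w arbitrary: x s)
  case (Cons a w)
  have "nullwalks E (a # w) x s \<le> (\<Sum>y\<in>nbrs E a x. d ^ length w)"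
    unfolding nullwalks.simps using Cons nbrs_subset by (intro sum_mono) blast
  then show ?case using card_nbrs Cons by simp
qed simp

text \<open>If the top of the stack is a step from \<open>u\<close> of the type other than
  \<open>a\<close>, then \<open>u\<close> is one of the \<open>d\<close> neighbours of type
  \<open>a\<close>, and it alone pops. All other steps push, so by induction only the types on the
  stack matter.\<close>

lemma nullwalks_eq_moment:
  assumes "x \<in> V" "nb_walk E v s x"
  shows "nullwalks E w x s = moment d w (map fst s)"
  using assms
proof (induction w arbitrary: x s)
  case (Cons a w)
  have IH: "nullwalks E w y (push a x y s) = moment d w (map fst (push a x y s))"
    if "y \<in> nbrs E a x" for y
    using that nbrs_subset nb_walk_push[OF Cons.prems(2) that] by (intro Cons.IH) blast+
  note c = card_nbrs[OF Cons.prems(1)]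
  show ?case
  proof (cases "s \<noteq> [] \<and> fst (hd s) \<noteq> a")
    case True
    then obtain b u t where s: "s = (b, u) # t" "b \<noteq> a" by (cases s) auto
    have u: "u \<in> nbrs E a x"
      using Cons.prems(2) s by (simp add: nbrs_converse[of a b u E x])
    have "nullwalks E (a # w) x s = (\<Sum>y\<in>nbrs E a x. moment d w (map fst (push a x y s)))"
      unfolding nullwalks.simps by (intro sum.cong IH refl)
    also have "\<dots> = moment d w (map fst t)
        + (\<Sum>y\<in>nbrs E a x - {u}. moment d w (map fst (push a x y s)))"
      using u s finite_nbrs[OF Cons.prems(1)] by (subst sum.remove[of _ u]) auto
    also have "(\<Sum>y\<in>nbrs E a x - {u}. moment d w (map fst (push a x y s)))
        = (\<Sum>y\<in>nbrs E a x - {u}. moment d w (a # map fst s))"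
      using s by (intro sum.cong) auto
    finally show ?thesis
      using s u c by simp
  next
    case False
    then have *: "push a x y s = (a, x) # s" for y by (cases s) auto
    have "nullwalks E (a # w) x s = (\<Sum>y\<in>nbrs E a x. moment d w (a # map fst s))"
      unfolding nullwalks.simps by (intro sum.cong refl) (simp add: IH[unfolded *] *)
    moreover have "\<not> (map fst s \<noteq> [] \<and> hd (map fst s) \<noteq> a)"
      using False by (cases s) auto
    ultimately show ?thesis by (simp only: moment.simps if_False sum_constant c of_nat_id)
  qed
qed auto

text \<open>The stack stays a reduced walk from \<open>v\<close> to the current vertex, and its
  length plus the number of remaining steps never exceeds \<open>k\<close>. If the walk ends at
  \<open>v\<close>, the stack is closed, hence empty by \<open>nb\<close>.\<close>

lemma nwalks_eq_nullwalks:
  assumes "x \<in> V" "nb_walk E v s x" "length s + length w \<le> k"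
    and nb: "\<And>s. nb_walk E v s v \<Longrightarrow> length s \<le> k \<Longrightarrow> s = []"
  shows "nwalks E w x v = nullwalks E w x s"
  using assms(1-3)
proof (induction w arbitrary: x s)
  case Nil
  then show ?case using nb[of s] by auto
next
  case (Cons a w)
  have "nwalks E w y v = nullwalks E w y (push a x y s)" if "y \<in> nbrs E a x" for y
    using that Cons.prems nbrs_subset nb_walk_push length_push[of a x y s]
    by (intro Cons.IH) fastforce+
  then show ?case by simp
qed

lemma nwalks_eq_moment:
  assumes "v \<in> V" "\<And>s. nb_walk E v s v \<Longrightarrow> length s \<le> length w \<Longrightarrow> s = []"
  shows "nwalks E w v v = moment d w []"
  using assms nwalks_eq_nullwalks[of v v "[]" w "length w"] nullwalks_eq_moment[of v v "[]" w]
  by simp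

lemma nwalks_moment_diff:
  assumes "v \<in> V"
  shows "\<bar>real (nwalks E w v v) - real (moment d w [])\<bar> \<le> real d ^ length w"
proof -
  \<comment> \<open>\<open>moment\<close> mentions no digraph, but it equals a walk count at
    \<open>v\<close> and inherits its bound.\<close>
  have "moment d w [] \<le> d ^ length w"
    using nullwalks_eq_moment[of v v "[]" w] nullwalks_le[of v w "[]"] assms by simp
  then show ?thesis
    using nwalks_le[OF assms, of w v]
    by (auto simp: abs_le_iff simp flip: of_nat_power)
qed

end

section \<open>Distance in the underlying graph and arcs on short cycles\<close>

text \<open>Because the identity is included, the \<open>i\<close>-th power of this relation is
  distance at most \<open>i\<close> when orientations are disregarded.\<close>

definition adj :: "('a \<times> 'a) set \<Rightarrow> ('a \<times> 'a) set" where
  "adj F = Id \<union> F \<union> F\<inverse>"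

lemma adj_refl [simp]: "(x, x) \<in> adj F"
  by (simp add: adj_def)

lemma relpow_adj_mono:
  assumes "(x, y) \<in> adj F ^^ i" "F \<subseteq> F'" "i \<le> j"
  shows "(x, y) \<in> adj F' ^^ j"
proof -
  have "adj F \<subseteq> adj F'"
    using assms(2) by (auto simp: adj_def)
  then have "adj F ^^ i \<subseteq> adj F' ^^ i"
    by (induction i) (simp_all add: relcomp_mono)
  moreover have "(y, y) \<in> adj F' ^^ n" for n
    by (induction n) (auto intro: relpow_Suc_I)
  ultimately have "(x, y) \<in> adj F' ^^ (i + (j - i))"
    unfolding relpow_add using assms(1) by blast
  then show ?thesis using assms(3) by simp
qed

lemma relpow_adj_sym: "(x, y) \<in> adj F ^^ i \<Longrightarrow> (y, x) \<in> adj F ^^ i"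
proof (induction i arbitrary: y)
  case (Suc i)
  then obtain z where "(x, z) \<in> adj F ^^ i" "(z, y) \<in> adj F" by auto
  then show ?case using Suc.IH by (intro relpow_Suc_I2[of y z]) (auto simp: adj_def)
qed auto

lemma relpow_adj_trans:
  "(x, y) \<in> adj F ^^ i \<Longrightarrow> (y, z) \<in> adj F ^^ j \<Longrightarrow> (x, z) \<in> adj F ^^ (i + j)"
  by (auto simp: relpow_add)

text \<open>A path from \<open>v\<close> either avoids the arc or runs through both of its
  ends.\<close>

lemma relpow_adj_delete_arc:
  assumes "(v, z) \<in> adj F ^^ i"
  shows "(v, z) \<in> adj (F - {arc a p q}) ^^ i \<or> (v, p) \<in> adj F ^^ i \<and> (v, q) \<in> adj F ^^ i"
  using assms
proof (induction i arbitrary: z)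
  case (Suc i)
  then obtain y where y: "(v, y) \<in> adj F ^^ i" "(y, z) \<in> adj F" by auto
  from Suc.IH[OF y(1)] consider "(v, p) \<in> adj F ^^ i" "(v, q) \<in> adj F ^^ i"
    | "(v, y) \<in> adj (F - {arc a p q}) ^^ i" "(y, z) \<in> adj (F - {arc a p q})"
    | "(y, z) \<notin> adj (F - {arc a p q})" by blast
  then show ?case
  proof cases
    case 1
    then show ?thesis using relpow_adj_mono[of _ _ i F F "Suc i"] by auto
  next
    case 2
    then show ?thesis by auto
  next
    case 3
    then have "{y, z} = {p, q}" using y(2) by (cases a) (auto simp: adj_def)
    moreover have "(v, y) \<in> adj F ^^ Suc i" "(v, z) \<in> adj F ^^ Suc i"
      using Suc.prems relpow_adj_mono[OF y(1), of F "Suc i"] by auto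
    ultimately show ?thesis by (metis doubleton_eq_iff)
  qed
qed auto

text \<open>For loop-free \<open>E\<close>, these are the arcs on an undirected cycle of length at
  most \<open>k + 1\<close>; two opposite arcs form a cycle of length 2.\<close>

definition short_cycle_arcs :: "nat \<Rightarrow> ('a \<times> 'a) set \<Rightarrow> ('a \<times> 'a) set" where
  "short_cycle_arcs k E = {(x, y) \<in> E. (x, y) \<in> adj (E - {(x, y)}) ^^ k}"

lemma arc_in_short_cycle_arcs:
  assumes "arc a p q \<in> E" "(p, q) \<in> adj (E - {arc a p q}) ^^ k"
  shows "arc a p q \<in> short_cycle_arcs k E"
  using assms relpow_adj_sym by (cases a) (auto simp: short_cycle_arcs_def)

text \<open>Induction on the walk. Let \<open>e\<close> be the arc of the step before the last, from
  \<open>t\<close> to \<open>u\<close>, and \<open>e'\<close> that of the last one. A path to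
  \<open>t\<close> avoiding \<open>e\<close> exists by induction. It cannot use \<open>e'\<close>,
  since it would then reach \<open>u\<close> without \<open>e\<close> and put \<open>e\<close> on a
  short cycle. Appending \<open>e\<close> gives a path to \<open>u\<close> that avoids
  \<open>e'\<close>.\<close>

lemma nb_walk_avoids_last_arc:
  assumes "irrefl E" "nb_walk E v ((a, u) # s) x"
    and "\<nexists>p q. (p, q) \<in> short_cycle_arcs k E \<and> (v, p) \<in> adj E ^^ k"
    and "2 * Suc (length s) \<le> k"
  shows "(v, u) \<in> adj (E - {arc a u x}) ^^ length s"
  using assms(2,4)
proof (induction s arbitrary: a u x)
  case (Cons bt s)
  obtain b t where bt: "bt = (b, t)" by force
  define e where "e = arc b t u"
  define e' where "e' = arc a u x"
  have e: "e \<in> E" "e' \<in> E" and nb: "b = a \<or> t \<noteq> x"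
    and walk: "nb_walk E v ((b, t) # s) u"
    using Cons.prems by (auto simp: bt nbrs_def e_def e'_def)
  have len: "2 * Suc (length s) \<le> k" using Cons.prems by simp
  have vt: "(v, t) \<in> adj (E - {e}) ^^ length s"
    using Cons.IH[OF walk len] by (simp add: e_def)
  have vt': "(v, t) \<in> adj E ^^ length s"
    using relpow_adj_mono[OF vt, of E] by auto
  have "(t, u) \<in> adj E" using e by (cases b) (auto simp: adj_def e_def)
  then have vu': "(v, u) \<in> adj E ^^ Suc (length s)" using vt' by auto
  \<comment> \<open>Paths from \<open>v\<close> to both \<open>t\<close> and \<open>u\<close> would
    join these within \<open>2 * length s\<close> steps avoiding \<open>e\<close>; hence the factor
    2 in the length condition.\<close>
  have not_vu: "(v, u) \<notin> adj (E - {e}) ^^ length s"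
  proof
    assume "(v, u) \<in> adj (E - {e}) ^^ length s"
    then have "(t, u) \<in> adj (E - {e}) ^^ (length s + length s)"
      using relpow_adj_trans[OF relpow_adj_sym[OF vt]] by blast
    then have "(t, u) \<in> adj (E - {e}) ^^ k"
      by (rule relpow_adj_mono) (use len in auto)
    then have "e \<in> short_cycle_arcs k E"
      using arc_in_short_cycle_arcs e unfolding e_def by metis
    moreover have "(v, fst e) \<in> adj E ^^ k"
      using relpow_adj_mono[OF vt', of E k] relpow_adj_mono[OF vu', of E k] len
      by (cases b) (auto simp: e_def)
    ultimately show False using assms(3) by (metis prod.collapse)
  qed
  \<comment> \<open>For equal types, \<open>e = e'\<close> would be a loop; for different types, it
    would make the last step a backtrack.\<close>
  have "e \<noteq> e'"
    using nb e assms(1) by (cases a; cases b) (auto simp: e_def e'_def irrefl_def)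
  have "(v, t) \<in> adj (E - {e} - {e'}) ^^ length s"
    using relpow_adj_delete_arc[OF vt, of a u x] not_vu by (auto simp: e'_def)
  then have "(v, t) \<in> adj (E - {e'}) ^^ length s"
    by (rule relpow_adj_mono) auto
  moreover have "(t, u) \<in> adj (E - {e'})"
    using e \<open>e \<noteq> e'\<close> by (cases b) (auto simp: adj_def e_def)
  ultimately show ?case by (auto simp: e'_def)
qed auto

text \<open>Otherwise \<open>nb_walk_avoids_last_arc\<close> joins \<open>v\<close> to the origin of
  the last step without using its arc, and this very arc lies on a short cycle at
  \<open>v\<close>.\<close>

lemma closed_nb_walk_imp_short_cycle_arc:
  assumes "irrefl E" "nb_walk E v s v" "s \<noteq> []" "2 * length s \<le> k"
  shows "\<exists>p q. (p, q) \<in> short_cycle_arcs k E \<and> (v, p) \<in> adj E ^^ k"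
proof (rule ccontr)
  assume *: "\<not> ?thesis"
  obtain a u t where s: "s = (a, u) # t" using assms by (cases s) auto
  have e: "arc a u v \<in> E" using assms s by (auto simp: nbrs_def)
  have "(v, u) \<in> adj (E - {arc a u v}) ^^ length t"
    using nb_walk_avoids_last_arc[of E v a u t v k] * assms unfolding s by simp
  then have vu: "(v, u) \<in> adj (E - {arc a u v}) ^^ k"
    by (rule relpow_adj_mono) (use assms s in auto)
  then have "arc a u v \<in> short_cycle_arcs k E"
    using e relpow_adj_sym by (intro arc_in_short_cycle_arcs) auto
  moreover have "(v, u) \<in> adj E ^^ k" "(v, v) \<in> adj E ^^ k"
    by (rule relpow_adj_mono[OF vu], simp_all) (rule relpow_adj_mono[of v v 0 E], simp_all)
  ultimately show False using * by (cases a) (simp_all only: arc_simps, blast+)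
qed

section \<open>Sizes of balls and numbers of arcs\<close>

context regular_arcs
begin

text \<open>One step of \<open>adj\<close> stays or moves along one of at most \<open>2 * d\<close>
  arcs, so each radius costs a factor \<open>2 * d + 1\<close>.\<close>

lemma card_ball:
  assumes "x \<in> V"
  shows "(adj E ^^ m) `` {x} \<subseteq> V \<and> finite ((adj E ^^ m) `` {x})
    \<and> card ((adj E ^^ m) `` {x}) \<le> (2 * d + 1) ^ m"
proof (induction m)
  case 0
  then show ?case using assms by simp
next
  case (Suc m)
  define B where "B = (adj E ^^ m) `` {x}"
  have B: "B \<subseteq> V" "finite B" "card B \<le> (2 * d + 1) ^ m"
    using Suc by (simp_all add: B_def)
  have adj: "adj E `` {z} = insert z (nbrs E One z \<union> nbrs E Star z)" for z
    by (auto simp: adj_def nbrs_def)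
  have fin: "finite (adj E `` {z})" and sub: "adj E `` {z} \<subseteq> V" if "z \<in> B" for z
    using that B(1) finite_nbrs nbrs_subset unfolding adj by auto
  have card: "card (adj E `` {z}) \<le> 2 * d + 1" if "z \<in> B" for z
  proof -
    have "z \<in> V" using that B(1) by auto
    then have "card (nbrs E One z \<union> nbrs E Star z) \<le> 2 * d"
      using card_Un_le[of "nbrs E One z" "nbrs E Star z"] card_nbrs by simp
    then show ?thesis
      unfolding adj using finite_nbrs[OF \<open>z \<in> V\<close>] by (simp add: card_insert_if)
  qed
  have eq: "(adj E ^^ Suc m) `` {x} = (\<Union>z\<in>B. adj E `` {z})"
    by (auto simp: B_def)
  have "card (\<Union>z\<in>B. adj E `` {z}) \<le> (\<Sum>z\<in>B. card (adj E `` {z}))"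
    by (rule card_UN_le[OF B(2)])
  also have "\<dots> \<le> card B * (2 * d + 1)"
    using sum_bounded_above[of B "\<lambda>z. card (adj E `` {z})" "2 * d + 1"] card by simp
  also have "\<dots> \<le> (2 * d + 1) ^ m * (2 * d + 1)"
    using B(3) by (rule mult_right_mono) simp
  finally show ?case
    unfolding eq using fin sub B(2) by (auto simp: mult.commute)
qed

lemma card_arcs_into:
  assumes "finite S" "S \<subseteq> V"
  shows "card {(a, b) \<in> E. a \<in> S} = d * card S"
proof -
  have "{(a, b) \<in> E. a \<in> S} = Sigma S (nbrs E One)"
    by (auto simp: nbrs_def)
  then show ?thesis
    using assms card_nbrs finite_nbrs by (auto simp: card_SigmaI subset_iff)
qed

end

section \<open>Switchings and the number of arcs on short cycles\<close>

text \<open>The tails \<open>x\<close> and \<open>a\<close> exchange their heads, which preserves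
  all degrees when both new arcs were absent before.\<close>

definition switch :: "'a \<Rightarrow> 'a \<Rightarrow> 'a \<Rightarrow> 'a \<Rightarrow> ('a \<times> 'a) set \<Rightarrow> ('a \<times> 'a) set" where
  "switch x y a b E = E - {(x, y), (a, b)} \<union> {(x, b), (a, y)}"

lemma nbrs_switch_One:
  assumes "(x, y) \<in> E" "(a, b) \<in> E" "(x, b) \<notin> E" "(a, y) \<notin> E"
  shows "nbrs (switch x y a b E) One v =
    (if v = x then insert b (nbrs E One x - {y})
     else if v = a then insert y (nbrs E One a - {b}) else nbrs E One v)"
  using assms by (auto simp: nbrs_def switch_def)

lemma nbrs_switch_Star:
  assumes "(x, y) \<in> E" "(a, b) \<in> E" "(x, b) \<notin> E" "(a, y) \<notin> E"
  shows "nbrs (switch x y a b E) Star v =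
    (if v = b then insert x (nbrs E Star b - {a})
     else if v = y then insert a (nbrs E Star y - {x}) else nbrs E Star v)"
  using assms by (auto simp: nbrs_def switch_def)

lemma regular_arcs_switch:
  assumes "regular_arcs d V E" "(x, y) \<in> E" "(a, b) \<in> E" "(x, b) \<notin> E" "(a, y) \<notin> E"
  shows "regular_arcs d V (switch x y a b E)"
proof -
  interpret regular_arcs d V E by fact
  have V: "x \<in> V" "y \<in> V" "a \<in> V" "b \<in> V"
    using assms(2,3) arcs by auto
  have n: "y \<in> nbrs E One x" "b \<notin> nbrs E One x" "b \<in> nbrs E One a" "y \<notin> nbrs E One a"
    "a \<in> nbrs E Star b" "x \<notin> nbrs E Star b" "x \<in> nbrs E Star y" "a \<notin> nbrs E Star y"
    using assms by (auto simp: nbrs_def)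
  have "card (nbrs (switch x y a b E) l v) = d" if "v \<in> V" for l v
    using card_nbrs V that n finite_nbrs pos
    by (cases l) (auto simp: nbrs_switch_One[OF assms(2-5)] nbrs_switch_Star[OF assms(2-5)])
  then show ?thesis
    using arcs V pos by unfold_locales (auto simp: switch_def)
qed

text \<open>A switching is undone by another one, so the new arc set and the four vertices determine
  the old arc set.\<close>

lemma switch_switch:
  assumes "(x, y) \<in> E" "(a, b) \<in> E" "(x, b) \<notin> E" "(a, y) \<notin> E"
  shows "switch x b a y (switch x y a b E) = E"
  using assms by (auto simp: switch_def)

text \<open>Of the two deleted arcs, the path avoids \<open>(x, y)\<close> by assumption, and it
  cannot use \<open>(a, b)\<close> because \<open>a\<close> is too far from
  \<open>x\<close>.\<close>

lemma path_survives_switch: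
  assumes "(x, z) \<in> adj (E - {(x, y)}) ^^ i" "(x, a) \<notin> adj E ^^ Suc i"
  shows "(x, z) \<in> adj (switch x y a b E) ^^ i"
  using assms
proof (induction i arbitrary: z)
  case (Suc i)
  obtain u where u: "(x, u) \<in> adj (E - {(x, y)}) ^^ i" "(u, z) \<in> adj (E - {(x, y)})"
    using Suc.prems by auto
  have "(x, u) \<in> adj E ^^ Suc (Suc i)"
    by (rule relpow_adj_mono[OF u(1)]) auto
  moreover have "(x, z) \<in> adj E ^^ Suc (Suc i)"
    by (rule relpow_adj_mono[OF Suc.prems(1)]) auto
  ultimately have "u \<noteq> a" "z \<noteq> a"
    using Suc.prems(2) by blast+
  then have "(u, z) \<in> adj (switch x y a b E)"
    using u(2) by (auto simp: adj_def switch_def)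
  moreover have "(x, a) \<notin> adj E ^^ Suc i"
    using Suc.prems(2) relpow_adj_mono[of x a "Suc i" E E "Suc (Suc i)"] by auto
  ultimately show ?case using Suc.IH[OF u(1)] by auto
qed auto

definition regular_arc_sets :: "nat \<Rightarrow> 'a set \<Rightarrow> ('a \<times> 'a) set set" where
  "regular_arc_sets d V = {E. regular_arcs d V E \<and> irrefl E}"

lemma finite_regular_arc_sets: "finite V \<Longrightarrow> finite (regular_arc_sets d V)"
  by (rule finite_subset[of _ "Pow (V \<times> V)"])
     (auto simp: regular_arc_sets_def dest: regular_arcs.arcs)

text \<open>Each failure would put \<open>a\<close> within distance 2 of \<open>x\<close>. The
  conclusions are what keeps the switched digraph regular and loop-free.\<close>

lemma far_arc:
  assumes "(x, y) \<in> E" "(a, b) \<in> E" "(x, a) \<notin> adj E ^^ (k + 2)"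
  shows "(x, b) \<notin> E" "(a, y) \<notin> E" "x \<noteq> b" "a \<noteq> y"
proof -
  have two: "(x, a) \<notin> adj E ^^ 2"
    using assms(3) relpow_adj_mono[of x a 2 E E "k + 2"] by auto
  then have *: "(x, z) \<notin> adj E \<or> (z, a) \<notin> adj E" for z
    by (auto simp: numeral_2_eq_2)
  show "(x, b) \<notin> E" "(a, y) \<notin> E" "x \<noteq> b" "a \<noteq> y"
    using *[of b] *[of y] *[of x] assms(1,2) by (auto simp: adj_def)
qed

text \<open>
  Switching \<open>(x, y), (a, b)\<close> to \<open>(x, b), (a, y)\<close> for \<open>a\<close> far from \<open>x\<close> destroys a short cycle
  through \<open>(x, y)\<close>, but keeps the path from \<open>x\<close> to \<open>y\<close>. So the old arc set is determined by the new
  one together with \<open>x\<close>, a vertex \<open>y\<close> near \<open>x\<close>, an arc out of \<open>x\<close> and an arc into \<open>y\<close>: a choice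
  among linearly many, against linearly many choices of \<open>(a, b)\<close>.
\<close>

lemma sum_short_cycle_arcs_le:
  fixes V :: "'a set"
  assumes "finite V" "2 * (2 * d + 1) ^ (k + 2) \<le> card V"
  shows "(\<Sum>E\<in>regular_arc_sets d V. card (short_cycle_arcs k E))
    \<le> 2 * d * (2 * d + 1) ^ k * card (regular_arc_sets d V)"
proof (cases "regular_arc_sets d V = {}")
  case False
  define \<Omega> where "\<Omega> = regular_arc_sets d V"
  define q where "q = 2 * d + 1"
  define N where "N = card V"
  \<comment> \<open>Distance above \<open>k + 1\<close> protects the path from \<open>x\<close> to
    \<open>y\<close>, and distance above 2 makes the switching admissible; radius
    \<open>k + 2\<close> gives both.\<close>
  define far where "far E x = {(a, b) \<in> E. (x, a) \<notin> adj E ^^ (k + 2)}" for E :: "('a \<times> 'a) set" and x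
  define L where "L = (SIGMA E : \<Omega>. SIGMA e : short_cycle_arcs k E. far E (fst e))"
  define R where "R = (SIGMA E : \<Omega>. SIGMA x : V. SIGMA y : (adj E ^^ k) `` {x}. 
      nbrs E One x \<times> nbrs E Star y)"
  \<comment> \<open>\<open>f\<close> switches and records \<open>b\<close> as an out-neighbour of
    \<open>x\<close> and \<open>a\<close> as an in-neighbour of \<open>y\<close>; \<open>g\<close>
    switches back.\<close>
  define f where "f = (\<lambda>(E, (x, y), (a, b)). (switch x y a b E, x, y, b, a :: 'a))"
  define g where "g = (\<lambda>(E, x, y, b, a). (switch x b a y E, (x, y), (a, b :: 'a)))"
  have reg: "regular_arcs d V E" and irr: "irrefl E" if "E \<in> \<Omega>" for E
    using that by (auto simp: \<Omega>_def regular_arc_sets_def)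
  have fin\<Omega>: "finite \<Omega>" using finite_regular_arc_sets assms(1) by (simp add: \<Omega>_def)
  have d: "d > 0" using False regular_arcs.pos by (force simp: regular_arc_sets_def)
  have N: "2 * q ^ (k + 2) \<le> N" "N > 0"
    using assms(2) by (auto simp: q_def N_def intro: Nat.gr0I)
  have finE: "finite E" if "E \<in> \<Omega>" for E
    using reg[OF that] assms(1) by (meson finite_cartesian_product finite_subset regular_arcs.arcs)
  have LD: "(x, y) \<in> E" "(x, y) \<in> adj (E - {(x, y)}) ^^ k" "(a, b) \<in> E" "E \<in> \<Omega>"
      "(x, a) \<notin> adj E ^^ (k + 2)" "(x, b) \<notin> E" "(a, y) \<notin> E" "x \<noteq> b" "a \<noteq> y"
    if "(E, (x, y), (a, b)) \<in> L" for E x y a b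
  proof -
    show *: "(x, y) \<in> E" "(x, y) \<in> adj (E - {(x, y)}) ^^ k" "(a, b) \<in> E" "E \<in> \<Omega>"
      "(x, a) \<notin> adj E ^^ (k + 2)"
      using that by (auto simp: L_def short_cycle_arcs_def far_def)
    show "(x, b) \<notin> E" "(a, y) \<notin> E" "x \<noteq> b" "a \<noteq> y"
      using far_arc[OF *(1,3,5)] by auto
  qed
  have gf: "g (f l) = l" if "l \<in> L" for l
  proof -
    obtain E x y a b where l: "l = (E, (x, y), (a, b))" by (metis prod.exhaust)
    show ?thesis
      using switch_switch[of x y E a b] LD[of E x y a b] that by (simp add: l f_def g_def)
  qed
  have "f l \<in> R" if "l \<in> L" for l
  proof -
    obtain E x y a b where l: "l = (E, (x, y), (a, b))" by (metis prod.exhaust)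
    note D = LD[OF that[unfolded l]]
    define E' where "E' = switch x y a b E"
    have "regular_arcs d V E'"
      unfolding E'_def using D reg by (intro regular_arcs_switch) auto
    moreover have "irrefl E'"
      using irr[OF D(4)] D(8,9) by (auto simp: irrefl_def E'_def switch_def)
    moreover have "(x, a) \<notin> adj E ^^ Suc k"
      using D(5) relpow_adj_mono[of x a "Suc k" E E "k + 2"] by auto
    then have "(x, y) \<in> adj E' ^^ k"
      unfolding E'_def using D(2) by (rule path_survives_switch[rotated])
    moreover have "x \<in> V"
      using D(1) regular_arcs.arcs[OF reg[OF D(4)]] by auto
    moreover have "(x, b) \<in> E'" "(a, y) \<in> E'"
      by (auto simp: E'_def switch_def)
    ultimately show ?thesis
      by (auto simp: l f_def R_def \<Omega>_def regular_arc_sets_def nbrs_def simp flip: E'_def)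
  qed
  moreover have "inj_on f L"
    using gf by (rule inj_on_inverseI)
  \<comment> \<open>There are \<open>N\<close> choices for \<open>x\<close>, at most
    \<open>q ^ k\<close> for \<open>y\<close> in the ball around it, and \<open>d\<close> each for
    \<open>b\<close> and \<open>a\<close>.\<close>
  moreover have R: "finite R \<and> card R \<le> card \<Omega> * (N * (q ^ k * (d * d)))"
  proof -
    have "finite (SIGMA x : V. SIGMA y : (adj E ^^ k) `` {x}. nbrs E One x \<times> nbrs E Star y) \<and>
      card (SIGMA x : V. SIGMA y : (adj E ^^ k) `` {x}. nbrs E One x \<times> nbrs E Star y)
        \<le> N * (q ^ k * (d * d))" if "E \<in> \<Omega>" for E
    proof -
      interpret regular_arcs d V E using reg that .
      have "finite (SIGMA y : (adj E ^^ k) `` {x}. nbrs E One x \<times> nbrs E Star y) \<and>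
        card (SIGMA y : (adj E ^^ k) `` {x}. nbrs E One x \<times> nbrs E Star y) \<le> q ^ k * (d * d)"
        if x: "x \<in> V" for x
      proof -
        note B = card_ball[OF x, of k]
        have f: "finite (nbrs E One x \<times> nbrs E Star y)" "card (nbrs E One x \<times> nbrs E Star y) = d * d"
          if "y \<in> (adj E ^^ k) `` {x}" for y
          using that B x finite_nbrs card_nbrs by (auto simp: card_cartesian_product subset_iff)
        have "card (SIGMA y : (adj E ^^ k) `` {x}. nbrs E One x \<times> nbrs E Star y)
          = card ((adj E ^^ k) `` {x}) * (d * d)"
          using f B by (subst card_SigmaI) auto
        moreover have "finite (SIGMA y : (adj E ^^ k) `` {x}. nbrs E One x \<times> nbrs E Star y)"
          by (rule finite_SigmaI) (use f B in blast)+
        ultimately show ?thesis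
          using B by (simp add: q_def mult_right_mono)
      qed
      note S = this
      have "card (SIGMA x : V. SIGMA y : (adj E ^^ k) `` {x}. nbrs E One x \<times> nbrs E Star y)
        = (\<Sum>x\<in>V. card (SIGMA y : (adj E ^^ k) `` {x}. nbrs E One x \<times> nbrs E Star y))"
        using S assms(1) by (intro card_SigmaI) auto
      also have "\<dots> \<le> (\<Sum>x\<in>V. q ^ k * (d * d))"
        using S by (intro sum_mono) auto
      finally show ?thesis
        using S assms(1) by (auto simp: N_def intro!: finite_SigmaI)
    qed
    note S = this
    have "card R = (\<Sum>E\<in>\<Omega>. 
        card (SIGMA x : V. SIGMA y : (adj E ^^ k) `` {x}. nbrs E One x \<times> nbrs E Star y))"
      unfolding R_def using S fin\<Omega> by (intro card_SigmaI) auto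
    also have "\<dots> \<le> (\<Sum>E\<in>\<Omega>. N * (q ^ k * (d * d)))"
      using S by (intro sum_mono) auto
    finally show ?thesis
      using S fin\<Omega> by (auto simp: R_def intro!: finite_SigmaI)
  qed
  ultimately have "card L \<le> card R"
    by (intro card_inj_on_le[of f]) auto
  also note conjunct2[OF R]
  finally have upper: "card L \<le> card \<Omega> * (N * (q ^ k * (d * d)))" .
  \<comment> \<open>By the assumption on \<open>card V\<close>, the ball of radius
    \<open>k + 2\<close> contains at most half of the vertices, so at least half of the
    \<open>d * N\<close> arcs start outside it.\<close>
  have far: "d * N \<le> 2 * card (far E (fst e))" if "E \<in> \<Omega>" "e \<in> short_cycle_arcs k E" for E e
  proof -
    interpret regular_arcs d V E using reg that(1) .
    define B where "B = (adj E ^^ (k + 2)) `` {fst e}"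
    have "fst e \<in> V" using that(2) arcs by (auto simp: short_cycle_arcs_def)
    from card_ball[OF this, of "k + 2"]
    have B: "B \<subseteq> V" "finite B" "card B \<le> q ^ (k + 2)" by (simp_all only: B_def q_def)
    have "far E (fst e) = {(a, b) \<in> E. a \<in> V - B}"
      using arcs by (auto simp: far_def B_def)
    then have "card (far E (fst e)) = d * (N - card B)"
      using card_arcs_into[of "V - B"] assms(1) B by (simp add: N_def card_Diff_subset)
    moreover have "N \<le> 2 * (N - card B)" using N B(3) by linarith
    ultimately show ?thesis
      by (metis mult.left_commute mult_le_mono2)
  qed
  have finS: "finite (short_cycle_arcs k E)" "finite (far E x)" if "E \<in> \<Omega>" for E x
    using finE[OF that] by (auto simp: short_cycle_arcs_def far_def intro: finite_subset[of _ E])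
  have "card L = (\<Sum>E\<in>\<Omega>. \<Sum>e\<in>short_cycle_arcs k E. card (far E (fst e)))"
    unfolding L_def using finS fin\<Omega> by (subst card_SigmaI) (auto intro!: sum.cong card_SigmaI)
  then have "2 * card L = (\<Sum>E\<in>\<Omega>. \<Sum>e\<in>short_cycle_arcs k E. 2 * card (far E (fst e)))"
    by (simp add: sum_distrib_left)
  also have "\<dots> \<ge> (\<Sum>E\<in>\<Omega>. \<Sum>e\<in>short_cycle_arcs k E. d * N)"
    using far by (intro sum_mono)
  finally have "(d * N) * (\<Sum>E\<in>\<Omega>. card (short_cycle_arcs k E)) \<le> 2 * card L"
    by (simp add: sum_distrib_left mult_ac)
  also have "\<dots> \<le> (d * N) * (2 * d * q ^ k * card \<Omega>)"
    using upper by (simp add: mult_ac)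
  \<comment> \<open>Cancelling \<open>d * N\<close> leaves a bound per digraph that is independent
    of \<open>N\<close>.\<close>
  finally show ?thesis
    using d N(2) by (simp add: \<Omega>_def q_def)
qed simp

section \<open>Reduced walks in the tree\<close>

lemma foldr_rcons_append: "freely_reduced (u @ v) \<Longrightarrow> foldr rcons u v = u @ v"
proof (induction u)
  case (Cons x u)
  then have "freely_reduced (u @ v)" "u @ v = [] \<or> hd (u @ v) \<noteq> flip x"
    by (auto simp: freely_reduced_Cons)
  then show ?case using Cons.IH by (cases "u @ v") auto
qed simp

lemma freely_reduced_appendD: "freely_reduced (u @ v) \<Longrightarrow> freely_reduced u"
  by (simp add: freely_reduced_def successively_append_iff)

text \<open>Reduction works from the left, but arcs multiply on the right: there a single letter can
  cancel only against the last letter of a reduced word.\<close>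

lemma foldr_rcons_single:
  assumes "freely_reduced u"
  shows "foldr rcons u [g] = (if u \<noteq> [] \<and> last u = flip g then butlast u else u @ [g])"
proof (cases u rule: rev_cases)
  case (snoc v h)
  show ?thesis
  proof (cases "h = flip g")
    case True
    then show ?thesis
      using assms freely_reduced_appendD[of v "[h]"] by (simp add: snoc foldr_rcons_Nil)
  next
    case False
    then have "freely_reduced (v @ [h, g])"
      using assms by (auto simp: snoc freely_reduced_def successively_append_iff flip_eq_iff)
    then show ?thesis
      using False by (auto simp: snoc foldr_rcons_append)
  qed
qed simp

lemma foldr_rcons_flip:
  assumes "freely_reduced u" "v = foldr rcons u [g]"
  shows "u = foldr rcons v [flip g]"
proof -
  have "foldr rcons v [flip g] = foldr rcons u (foldr rcons [g] [flip g])"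
    unfolding assms(2) by (rule foldr_rcons_assoc) (simp add: freely_reduced_Cons)
  then show ?thesis using assms(1) by (simp add: foldr_rcons_Nil)
qed

abbreviation tree_arcs :: "nat \<Rightarrow> (fletter list \<times> fletter list) set" where
  "tree_arcs d \<equiv> parcs (directed_tree d)"

text \<open>A step of type \<open>One\<close> multiplies by a generator and one of type
  \<open>Star\<close> by an inverse generator; \<open>a = One\<close> is the exponent bit.\<close>

lemma nbrs_tree_arcs:
  assumes "v \<in> nbrs (tree_arcs d) a u"
  shows "freely_reduced u \<and> (\<exists>i. v = foldr rcons u [(i, a = One)])"
proof (cases a)
  case One
  then show ?thesis
    using assms by (auto simp: nbrs_def directed_tree_def cayley_digraph_def free_group_def free_gen_def)
next
  case Star
  then obtain i where i: "u = foldr rcons v [(i, True)]" "freely_reduced v"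
    using assms by (auto simp: nbrs_def directed_tree_def cayley_digraph_def free_group_def free_gen_def)
  then have "freely_reduced u"
    by (simp add: freely_reduced_foldr_rcons freely_reduced_Cons)
  moreover have "v = foldr rcons u [(i, False)]"
    using foldr_rcons_flip[OF i(2,1)] by (simp add: flip_def)
  ultimately show ?thesis using Star by auto
qed

text \<open>Each step of a reduced walk from the root appends a letter: cancelling the last letter
  would return to the previous vertex by a step of the other type. The second conjunct carries the
  last letter through the induction. Hence no nonempty reduced walk closes up at the root.\<close>

lemma nb_walk_tree:
  assumes "nb_walk (tree_arcs d) [] s x"
  shows "length x = length s \<and>
    (case s of [] \<Rightarrow> True | (a, u) # _ \<Rightarrow> \<exists>i. x = u @ [(i, a = One)])"
  using assms
proof (induction s arbitrary: x)
  case (Cons au s)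
  obtain a u where au: "au = (a, u)" by force
  obtain i where i: "x = foldr rcons u [(i, a = One)]" and u: "freely_reduced u"
    using Cons.prems nbrs_tree_arcs[of x d a u] by (auto simp: au)
  have IH: "length u = length s"
    "case s of [] \<Rightarrow> True | (b, t) # _ \<Rightarrow> \<exists>j. u = t @ [(j, b = One)]"
    using Cons.IH[of u] Cons.prems by (auto simp: au)
  have "\<not> (u \<noteq> [] \<and> last u = flip (i, a = One))"
  proof
    assume *: "u \<noteq> [] \<and> last u = flip (i, a = One)"
    then obtain b t s' where s: "s = (b, t) # s'" using IH(1) by (cases s) auto
    then obtain j where j: "u = t @ [(j, b = One)]" using IH(2) by auto
    have "x = t"
      using i u * j freely_reduced_appendD[of t] by (simp add: foldr_rcons_single foldr_rcons_Nil)
    moreover have "b \<noteq> a" using * j by (auto simp: flip_def)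
    ultimately show False using Cons.prems s by (auto simp: au)
  qed
  then have "x = u @ [(i, a = One)]"
    using i u by (auto simp: foldr_rcons_single)
  then show ?case using IH(1) by (simp add: au)
qed simp

section \<open>Regular digraphs as regular arc sets\<close>

lemma card_nbrs_digraph:
  "card (nbrs (parcs G) One v) = out_degree (with_proj G) v"
  "card (nbrs (parcs G) Star v) = in_degree (with_proj G) v"
proof -
  have "out_arcs (with_proj G) v = Pair v ` nbrs (parcs G) One v"
    "in_arcs (with_proj G) v = (\<lambda>u. (u, v)) ` nbrs (parcs G) Star v"
    by (auto simp: out_arcs_def in_arcs_def nbrs_def)
  then show "card (nbrs (parcs G) One v) = out_degree (with_proj G) v"
    "card (nbrs (parcs G) Star v) = in_degree (with_proj G) v"
    by (simp_all add: out_degree_def in_degree_def card_image inj_on_def)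
qed

lemma regular_arcs_of_digraph:
  assumes "regular_digraph d (with_proj G)" "parcs G \<subseteq> pverts G \<times> pverts G" "d > 0"
  shows "regular_arcs d (pverts G) (parcs G)"
proof
  fix v a
  assume "v \<in> pverts G"
  then show "card (nbrs (parcs G) a v) = d"
    using assms(1) by (cases a) (auto simp: regular_digraph_def card_nbrs_digraph)
qed (use assms in auto)

lemma cayley_arcs:
  assumes "group G" "S \<subseteq> carrier G"
  shows "parcs (cayley_digraph G S) \<subseteq> pverts (cayley_digraph G S) \<times> pverts (cayley_digraph G S)"
proof -
  interpret group G by fact
  show ?thesis using assms(2) by (auto simp: cayley_digraph_def)
qed

lemma regular_arcs_tree:
  assumes "d > 0"
  shows "regular_arcs d (pverts (directed_tree d)) (tree_arcs d)"
proof -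
  have "free_gen ` {1..d} \<subseteq> carrier (free_group d)"
    by (auto simp: free_gen_def free_group_def freely_reduced_Cons)
  from cayley_arcs[OF group_free_group this] show ?thesis
    by (intro regular_arcs_of_digraph regular_directed_tree assms) (simp add: directed_tree_def)
qed

section \<open>Entries of words as walk counts\<close>

primrec walks :: "('a \<times> 'a) set \<Rightarrow> word \<Rightarrow> 'a \<Rightarrow> 'a \<Rightarrow> 'a list set" where
  "walks E [] x v = (if x = v then {[x]} else {})"
| "walks E (a # w) x v = (\<Union>y\<in>nbrs E a x. Cons x ` walks E w y v)"

lemma hd_walks: "p \<in> walks E w x v \<Longrightarrow> p \<noteq> [] \<and> hd p = x"
  by (cases w) (auto split: if_splits)

lemma (in regular_arcs) card_walks:
  "x \<in> V \<Longrightarrow> finite (walks E w x v) \<and> card (walks E w x v) = nwalks E w x v"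
proof (induction w arbitrary: x)
  case (Cons a w)
  have y: "y \<in> V" if "y \<in> nbrs E a x" for y using that nbrs_subset by auto
  have "card (walks E (a # w) x v) = (\<Sum>y\<in>nbrs E a x. card (Cons x ` walks E w y v))"
    unfolding walks.simps
    using Cons finite_nbrs y by (intro card_UN_disjoint) (auto dest!: hd_walks)
  then show ?case
    using Cons finite_nbrs y by (auto simp: card_image)
qed simp

text \<open>This identifies \<open>walks\<close> with the lists in the index set of
  \<open>entry_word\<close> whose product is 1.\<close>

lemma (in regular_arcs) walks_iff:
  assumes "x \<in> V"
  shows "p \<in> walks E w x v \<longleftrightarrow> length p = length w + 1 \<and> set p \<subseteq> V \<and> p ! 0 = x \<and> p ! length w = v
    \<and> (\<forall>i<length w. p ! (i + 1) \<in> nbrs E (w ! i) (p ! i))"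
  using assms
proof (induction w arbitrary: x p)
  case Nil
  then show ?case by (cases p) auto
next
  case (Cons a w)
  show ?case
  proof (cases p)
    case (Cons z q)
    have IH: "q \<in> walks E w y v \<longleftrightarrow> length q = length w + 1 \<and> set q \<subseteq> V \<and> q ! 0 = y \<and>
        q ! length w = v \<and> (\<forall>i<length w. q ! (i + 1) \<in> nbrs E (w ! i) (q ! i))"
      if "y \<in> nbrs E a x" for y
      using that nbrs_subset by (intro Cons.IH) auto
    have "p \<in> walks E (a # w) x v \<longleftrightarrow> z = x \<and> (\<exists>y\<in>nbrs E a x. q \<in> walks E w y v)"
      by (auto simp: Cons)
    also have "\<dots> \<longleftrightarrow> z = x \<and> length q = length w + 1 \<and> set q \<subseteq> V \<and> q ! 0 \<in> nbrs E a x \<and>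
        q ! length w = v \<and> (\<forall>i<length w. q ! (i + 1) \<in> nbrs E (w ! i) (q ! i))"
      using IH by auto
    also have "\<dots> \<longleftrightarrow> length p = length (a # w) + 1 \<and> set p \<subseteq> V \<and> p ! 0 = x \<and> p ! length (a # w) = v
      \<and> (\<forall>i<length (a # w). p ! (i + 1) \<in> nbrs E ((a # w) ! i) (p ! i))"
      using Cons.prems by (auto simp: Cons All_less_Suc2)
    finally show ?thesis .
  qed auto
qed

lemma entry_letter_adjacency:
  "entry_letter (adjacency G) a x y = of_bool (y \<in> nbrs (parcs G) a x)"
  by (cases a) (auto simp: adjacency_def nbrs_def)

text \<open>Every product of adjacency entries is 0 or 1, so the infinite sum is the cardinality of
  the finite set \<open>walks\<close>.\<close>

lemma entry_word_eq_nwalks: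
  assumes "regular_arcs d (pverts G) (parcs G)" "x \<in> pverts G"
  shows "entry_word G w x v = nwalks (parcs G) w x v"
proof -
  interpret regular_arcs d "pverts G" "parcs G" by fact
  define P where "P = {p. length p = length w + 1 \<and> set p \<subseteq> pverts G \<and> p ! 0 = x \<and> p ! length w = v}"
  have prod: "(\<Prod>i<length w. entry_letter (adjacency G) (w ! i) (p ! i) (p ! (i + 1)))
      = of_bool (\<forall>i<length w. p ! (i + 1) \<in> nbrs (parcs G) (w ! i) (p ! i))" for p
    by (auto simp: entry_letter_adjacency intro!: prod.neutral)
  have "entry_word G w x v = (\<Sum>\<^sub>\<infinity>p\<in>P. of_bool (\<forall>i<length w. p ! (i + 1) \<in> nbrs (parcs G) (w ! i) (p ! i)))"
    unfolding entry_word_def P_def prod ..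
  also have "\<dots> = (\<Sum>\<^sub>\<infinity>p\<in>walks (parcs G) w x v. 1)"
    by (rule infsum_cong_neutral) (auto simp: walks_iff[OF assms(2)] P_def)
  also have "\<dots> = nwalks (parcs G) w x v"
    using card_walks[OF assms(2)] by simp
  finally show ?thesis .
qed

lemma tree_moment_eq:
  assumes "d > 0"
  shows "tree_moment d w = moment d w []"
proof -
  interpret regular_arcs d "pverts (directed_tree d)" "tree_arcs d"
    using regular_arcs_tree[OF assms] .
  have o: "[] \<in> pverts (directed_tree d)"
    by (simp add: directed_tree_def cayley_digraph_def free_group_def)
  have "s = []" if "nb_walk (tree_arcs d) [] s []" for s
    using nb_walk_tree[OF that] by simp
  then have "nwalks (tree_arcs d) w [] [] = moment d w []"
    using o by (intro nwalks_eq_moment)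
  moreover have "tree_root d = []" by (simp add: tree_root_def free_group_def)
  ultimately show ?thesis
    unfolding tree_moment_def using entry_word_eq_nwalks[OF regular_arcs_axioms o] by simp
qed

section \<open>The finite sample space and its nonemptiness\<close>

text \<open>On a fixed vertex set the arcs determine the digraph. Averages over digraphs thus become
  sums over arc sets, on which switchings act.\<close>

lemma bij_betw_regular_digraphs:
  assumes "d > 0"
  shows "bij_betw parcs (regular_digraphs d n) (regular_arc_sets d {1..n})"
proof (rule bij_betwI[where g = "\<lambda>E. \<lparr>pverts = {1..n}, parcs = E\<rparr>"])
  show "parcs \<in> regular_digraphs d n \<rightarrow> regular_arc_sets d {1..n}"
  proof
    fix G
    assume G: "G \<in> regular_digraphs d n"
    then interpret pair_digraph G by (simp add: regular_digraphs_def)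
    have "parcs G \<subseteq> pverts G \<times> pverts G" by (auto dest: in_arcsD1 in_arcsD2)
    then show "parcs G \<in> regular_arc_sets d {1..n}"
      using regular_arcs_of_digraph[of d G] G assms no_loops'
      by (auto simp: regular_digraphs_def regular_arc_sets_def irrefl_def)
  qed
  show "(\<lambda>E. \<lparr>pverts = {1..n}, parcs = E\<rparr>) \<in> regular_arc_sets d {1..n} \<rightarrow> regular_digraphs d n"
  proof
    fix E :: "(nat \<times> nat) set"
    assume E: "E \<in> regular_arc_sets d {1..n}"
    then interpret regular_arcs d "{1..n}" E by (simp add: regular_arc_sets_def)
    let ?G = "\<lparr>pverts = {1..n}, parcs = E\<rparr>"
    have "pair_digraph ?G"
    proof
      show "finite (parcs ?G)" using finite_subset[OF arcs] by simp
    qed (use arcs E in \<open>auto simp: regular_arc_sets_def irrefl_def\<close>)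
    then show "?G \<in> regular_digraphs d n"
      using card_nbrs card_nbrs_digraph[of ?G, symmetric]
      by (auto simp: regular_digraphs_def regular_digraph_def)
  qed
qed (auto simp: regular_digraphs_def)

lemma finite_regular_digraphs: "d > 0 \<Longrightarrow> finite (regular_digraphs d n)"
  using bij_betw_finite[OF bij_betw_regular_digraphs, of d n] finite_regular_arc_sets[of "{1..n}" d]
  by simp

text \<open>The integers modulo \<open>n\<close> on the representatives \<open>{1..n}\<close>, with
  \<open>n\<close> in the role of zero, so that Cayley digraphs have the required vertex
  set.\<close>

definition cyclic_group :: "nat \<Rightarrow> nat monoid" where
  "cyclic_group n =
     \<lparr> carrier = {1..n}, mult = (\<lambda>a b. if a + b \<le> n then a + b else a + b - n), one = n \<rparr>"

lemma group_cyclic_group: "n > 0 \<Longrightarrow> group (cyclic_group n)"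
proof (rule groupI)
  fix a assume "a \<in> carrier (cyclic_group n)" "n > 0"
  then show "\<exists>b\<in>carrier (cyclic_group n). b \<otimes>\<^bsub>cyclic_group n\<^esub> a = \<one>\<^bsub>cyclic_group n\<^esub>"
    by (intro bexI[of _ "if a = n then n else n - a"]) (auto simp: cyclic_group_def)
qed (auto simp: cyclic_group_def)

lemma regular_digraphs_nonempty:
  assumes "d > 0" "n > d"
  shows "regular_digraphs d n \<noteq> {}"
proof -
  define G where "G = cayley_digraph (cyclic_group n) {1..d}"
  have grp: "group (cyclic_group n)" using assms group_cyclic_group by simp
  have S: "{1..d} \<subseteq> carrier (cyclic_group n)" using assms by (auto simp: cyclic_group_def)
  have "regular_digraph d (with_proj G)"
    using regular_cayley_digraph[OF grp S] by (simp add: G_def)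
  moreover have "parcs G \<subseteq> pverts G \<times> pverts G"
    unfolding G_def by (rule cayley_arcs[OF grp S])
  moreover have V: "pverts G = {1..n}" by (simp add: G_def cayley_digraph_def cyclic_group_def)
  ultimately have "regular_arcs d {1..n} (parcs G)"
    using regular_arcs_of_digraph[of d G] assms by simp
  \<comment> \<open>A loop would need the identity \<open>n\<close> among the generators
    \<open>{1..d}\<close>, which \<open>n > d\<close> rules out.\<close>
  moreover have "irrefl (parcs G)"
    using assms by (auto simp: irrefl_def G_def cayley_digraph_def cyclic_group_def split: if_splits)
  ultimately have "parcs G \<in> regular_arc_sets d {1..n}"
    by (simp add: regular_arc_sets_def)
  then show ?thesis
    using bij_betw_regular_digraphs[OF assms(1), of n] by (auto simp: bij_betw_def)
qed

section \<open>Traces as counts of closed walks\<close>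

lemma mat_word_carrier:
  "A \<in> carrier_mat n n \<Longrightarrow> mat_word A w \<in> carrier_mat n n"
proof (induction w)
  case (Cons a w)
  then show ?case by (cases a) auto
qed auto

lemma mat_word_adjacency_mat:
  assumes "parcs G \<subseteq> {1..n} \<times> {1..n}" "i < n" "j < n"
  shows "mat_word (adjacency_mat n G) w $$ (i, j) = nwalks (parcs G) w (i + 1) (j + 1)"
  using assms(2)
proof (induction w arbitrary: i)
  case Nil
  then show ?case using assms by (auto simp: adjacency_mat_def)
next
  case (Cons a w)
  define A where "A = adjacency_mat n G"
  have A: "A \<in> carrier_mat n n" by (simp add: A_def adjacency_mat_def)
  then have letter: "mat_letter A a \<in> carrier_mat n n" by (cases a) auto
  have entry: "mat_letter A a $$ (i, k) = of_bool (k + 1 \<in> nbrs (parcs G) a (i + 1))" if "k < n" for k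
    using that Cons.prems
    by (cases a) (auto simp: A_def adjacency_mat_def adjacency_def nbrs_def)
  have nbrs: "nbrs (parcs G) a (i + 1) \<subseteq> {1..n}"
    using assms(1) by (cases a) (auto simp: nbrs_def)
  have "mat_word A (a # w) $$ (i, j) = (\<Sum>k<n. mat_letter A a $$ (i, k) * mat_word A w $$ (k, j))"
    using letter mat_word_carrier[OF A, of w] Cons.prems assms(3)
    by (simp add: scalar_prod_def lessThan_atLeast0)
  also have "\<dots> = (\<Sum>k<n. of_bool (Suc k \<in> nbrs (parcs G) a (i + 1)) * real (nwalks (parcs G) w (Suc k) (j + 1)))"
    using entry Cons.IH by (intro sum.cong) (auto simp: A_def)
  \<comment> \<open>The shift passes from matrix indices below \<open>n\<close> to the vertices
    \<open>{1..n}\<close>.\<close>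
  also have "\<dots> = (\<Sum>y=1..n. of_bool (y \<in> nbrs (parcs G) a (i + 1)) * real (nwalks (parcs G) w y (j + 1)))"
    by (rule sum.reindex_bij_witness[of _ "\<lambda>y. y - 1" Suc]) auto
  also have "\<dots> = (\<Sum>y\<in>nbrs (parcs G) a (i + 1). real (nwalks (parcs G) w y (j + 1)))"
    by (rule sum.mono_neutral_cong_right) (use nbrs in auto)
  finally show ?case by (simp add: A_def)
qed

lemma trace_mat_word_adjacency_mat:
  assumes "parcs G \<subseteq> {1..n} \<times> {1..n}"
  shows "mat_trace (mat_word (adjacency_mat n G) w) = (\<Sum>v=1..n. real (nwalks (parcs G) w v v))"
proof -
  have "mat_word (adjacency_mat n G) w \<in> carrier_mat n n"
    by (rule mat_word_carrier) (simp add: adjacency_mat_def)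
  then have "mat_trace (mat_word (adjacency_mat n G) w)
      = (\<Sum>i<n. real (nwalks (parcs G) w (Suc i) (Suc i)))"
    using mat_word_adjacency_mat[OF assms] by (simp add: mat_trace_def)
  also have "\<dots> = (\<Sum>v=1..n. real (nwalks (parcs G) w v v))"
    by (rule sum.reindex_bij_witness[of _ "\<lambda>y. y - 1" Suc]) auto
  finally show ?thesis .
qed

section \<open>Error estimate and limit\<close>

text \<open>Only vertices near an arc on a short cycle can deviate from \<open>moment\<close>. Each
  such arc spoils at most one ball, and each spoiled vertex costs at most
  \<open>d ^ length w\<close>.\<close>

lemma (in regular_arcs) nwalks_sum_moment_diff:
  assumes "finite V" "irrefl E"
  shows "\<bar>(\<Sum>v\<in>V. real (nwalks E w v v)) - real (card V) * moment d w []\<bar>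
    \<le> real (d ^ length w * ((2 * d + 1) ^ (2 * length w) * card (short_cycle_arcs (2 * length w) E)))"
proof -
  \<comment> \<open>Stacks have length at most \<open>length w\<close>, and
    \<open>closed_nb_walk_imp_short_cycle_arc\<close> asks for twice that.\<close>
  define k where "k = 2 * length w"
  define S where "S = short_cycle_arcs k E"
  define B where "B = (\<Union>e\<in>S. (adj E ^^ k) `` {fst e})"
  have S: "finite S" "fst ` S \<subseteq> V"
    using arcs assms(1) by (auto simp: S_def short_cycle_arcs_def intro: finite_subset[of _ "V \<times> V"])
  have B: "B \<subseteq> V" "finite B"
    using card_ball S unfolding B_def by blast+
  have "card B \<le> (\<Sum>e\<in>S. card ((adj E ^^ k) `` {fst e}))"
    unfolding B_def by (rule card_UN_le[OF S(1)])
  also have "\<dots> \<le> (\<Sum>e\<in>S. (2 * d + 1) ^ k)"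
    using card_ball S(2) by (intro sum_mono) blast
  finally have card: "card B \<le> (2 * d + 1) ^ k * card S" by (simp add: mult.commute)
  have good: "nwalks E w v v = moment d w []" if "v \<in> V" "v \<notin> B" for v
  proof (rule nwalks_eq_moment[OF that(1)], rule ccontr)
    fix s assume "nb_walk E v s v" "length s \<le> length w" "s \<noteq> []"
    then obtain p q where "(p, q) \<in> S" "(v, p) \<in> adj E ^^ k"
      using closed_nb_walk_imp_short_cycle_arc[of E v s k] assms(2) by (auto simp: k_def S_def)
    then show False using that(2) relpow_adj_sym unfolding B_def by force
  qed
  have "(\<Sum>v\<in>V. real (nwalks E w v v)) - real (card V) * moment d w []
      = (\<Sum>v\<in>V. real (nwalks E w v v) - moment d w [])"
    by (simp add: sum_subtractf)
  also have "\<dots> = (\<Sum>v\<in>B. real (nwalks E w v v) - moment d w [])"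
    using assms(1) B good by (intro sum.mono_neutral_right) auto
  also have "\<bar>\<dots>\<bar> \<le> (\<Sum>v\<in>B. \<bar>real (nwalks E w v v) - moment d w []\<bar>)"
    by (rule sum_abs)
  also have "\<dots> \<le> (\<Sum>v\<in>B. real d ^ length w)"
    using nwalks_moment_diff B(1) by (intro sum_mono) auto
  also have "\<dots> = real (d ^ length w * card B)"
    by simp
  also have "\<dots> \<le> real (d ^ length w * ((2 * d + 1) ^ k * card S))"
    using card by (intro of_nat_mono mult_left_mono) auto
  finally show ?thesis by (simp add: k_def S_def)
qed

text \<open>Averaging the deterministic error over all digraphs turns the number of short cycle arcs
  into its switching bound, so the error does not grow with \<open>n\<close>.\<close>

lemma expectation_trace_diff:
  assumes "d > 0" "n > d" "2 * (2 * d + 1) ^ (2 * length w + 2) \<le> n"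
  shows "\<bar>measure_pmf.expectation (random_regular_digraph d n)
      (\<lambda>G. mat_trace (mat_word (adjacency_mat n G) w)) - real n * moment d w []\<bar>
    \<le> real (d ^ length w * ((2 * d + 1) ^ (2 * length w) * (2 * d * (2 * d + 1) ^ (2 * length w))))"
proof -
  define \<Omega> where "\<Omega> = regular_digraphs d n"
  define k where "k = 2 * length w"
  define C where "C = d ^ length w * (2 * d + 1) ^ k"
  define X where "X G = mat_trace (mat_word (adjacency_mat n G) w)" for G
  define m where "m = real n * moment d w []"
  have \<Omega>: "finite \<Omega>" "\<Omega> \<noteq> {}"
    using finite_regular_digraphs regular_digraphs_nonempty assms by (simp_all add: \<Omega>_def)
  then have pos: "real (card \<Omega>) > 0" by (simp add: card_gt_0_iff)
  have bij: "bij_betw parcs \<Omega> (regular_arc_sets d {1..n})"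
    unfolding \<Omega>_def by (rule bij_betw_regular_digraphs[OF assms(1)])
  have diff: "\<bar>X G - m\<bar> \<le> real (C * card (short_cycle_arcs k (parcs G)))" if "G \<in> \<Omega>" for G
  proof -
    have G: "parcs G \<in> regular_arc_sets d {1..n}" using bij that by (auto simp: bij_betw_def)
    then interpret regular_arcs d "{1..n}" "parcs G" by (simp add: regular_arc_sets_def)
    have "X G = (\<Sum>v=1..n. real (nwalks (parcs G) w v v))"
      unfolding X_def by (rule trace_mat_word_adjacency_mat[OF arcs])
    then show ?thesis
      using nwalks_sum_moment_diff[of w] G
      by (simp add: regular_arc_sets_def m_def C_def k_def mult.assoc)
  qed
  have "(\<Sum>G\<in>\<Omega>. card (short_cycle_arcs k (parcs G)))
      = (\<Sum>E\<in>regular_arc_sets d {1..n}. card (short_cycle_arcs k E))"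
    by (rule sum.reindex_bij_betw[OF bij])
  also have "\<dots> \<le> 2 * d * (2 * d + 1) ^ k * card \<Omega>"
    using sum_short_cycle_arcs_le[of "{1..n}" d k] assms(3) bij_betw_same_card[OF bij]
    by (simp add: k_def)
  finally have sum: "(\<Sum>G\<in>\<Omega>. card (short_cycle_arcs k (parcs G))) \<le> 2 * d * (2 * d + 1) ^ k * card \<Omega>" .
  have "measure_pmf.expectation (random_regular_digraph d n) X - m = (\<Sum>G\<in>\<Omega>. X G - m) / card \<Omega>"
    using \<Omega> pos unfolding random_regular_digraph_def \<Omega>_def[symmetric]
    by (simp add: integral_pmf_of_set sum_subtractf field_simps)
  also have "\<bar>\<dots>\<bar> = \<bar>\<Sum>G\<in>\<Omega>. X G - m\<bar> / card \<Omega>"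
    by simp
  also have "\<dots> \<le> (\<Sum>G\<in>\<Omega>. real (C * card (short_cycle_arcs k (parcs G)))) / card \<Omega>"
    using diff by (intro divide_right_mono order_trans[OF sum_abs] sum_mono) auto
  also have "\<dots> = real (C * (\<Sum>G\<in>\<Omega>. card (short_cycle_arcs k (parcs G)))) / card \<Omega>"
    by (simp add: sum_distrib_left)
  also have "\<dots> \<le> real (C * (2 * d * (2 * d + 1) ^ k * card \<Omega>)) / card \<Omega>"
    using sum by (intro divide_right_mono of_nat_mono mult_left_mono) auto
  also have "\<dots> = real (C * (2 * d * (2 * d + 1) ^ k))"
    using pos by simp
  finally show ?thesis by (simp add: X_def[abs_def] m_def C_def k_def mult.assoc)
qed

theorem theorem1:
  fixes d :: nat and w :: word
  assumes "d \<ge> 2"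
  shows "(\<lambda>n. 1 / real n *
            measure_pmf.expectation (random_regular_digraph d n)
              (\<lambda>G. mat_trace (mat_word (adjacency_mat n G) w)))
         \<longlonglongrightarrow> tree_moment d w"
proof -
  \<comment> \<open>From \<open>N\<close> on, both \<open>n > d\<close> and the ball condition of
    the switching bound hold.\<close>
  define N where "N = Suc d + 2 * (2 * d + 1) ^ (2 * length w + 2)"
  define C where "C = real (d ^ length w * ((2 * d + 1) ^ (2 * length w) * (2 * d * (2 * d + 1) ^ (2 * length w))))"
  define X where "X n = measure_pmf.expectation (random_regular_digraph d n)
    (\<lambda>G. mat_trace (mat_word (adjacency_mat n G) w))" for n
  have "norm (1 / real n * X n - tree_moment d w) \<le> C * (1 / real n)" if "n \<ge> N" for n
  proof -
    have n: "n > 0" using that by (simp add: N_def)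
    have "\<bar>X n - real n * moment d w []\<bar> \<le> C"
      unfolding X_def C_def using that assms by (intro expectation_trace_diff) (simp_all add: N_def)
    then have "\<bar>X n - real n * moment d w []\<bar> / real n \<le> C / real n"
      by (rule divide_right_mono) simp
    also have "\<bar>X n - real n * moment d w []\<bar> / real n = \<bar>(X n - real n * moment d w []) / real n\<bar>"
      by simp
    also have "(X n - real n * moment d w []) / real n = 1 / real n * X n - tree_moment d w"
      using n assms by (simp add: tree_moment_eq field_simps)
    finally show ?thesis by simp
  qed
  then have "\<forall>\<^sub>F n in sequentially. norm (1 / real n * X n - tree_moment d w) \<le> C * (1 / real n)"
    by (auto simp: eventually_sequentially)
  moreover have "(\<lambda>n. C * (1 / real n)) \<longlonglongrightarrow> 0"
    using tendsto_mult_right_zero[OF lim_1_over_n] by simp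
  ultimately have "(\<lambda>n. 1 / real n * X n - tree_moment d w) \<longlonglongrightarrow> 0"
    by (rule Lim_null_comparison)
  then show ?thesis
    unfolding X_def by (simp only: LIM_zero_iff)
qed

end
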